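(* Let $X=N_{\mathbb R}/\Lambda$ be a real torus with integral structure of dimension $g$ with dual $\widehat X$, let $F_{E_X}:H^{\bullet,\bullet}(X)_{\mathbb Q}\to H^{\bullet,\bullet}(\widehat X)_{\mathbb Q}$ be the Fourier--Mukai transform on tropical cohomology, and for $p,q\ge0$ let $\alpha_{p,q}:H^{p,q}(X)\to H^{g-q,g-p}(\widehat X)$ be the composite $$H^{p,q}(X)\xrightarrow{\sim}H^{g-p,g-q}(X)^*\xrightarrow{\ \Psi_\Lambda^{\wedge (g-q)}\otimes\Psi_N^{\wedge(g-p)}\ }H^{g-q,g-p}(\widehat X),$$ where the first map is Poincaré duality and the second is induced by $c_1(\mathcal P_X)$. Then $$F_{E_X}|_{H^{p,q}(X)}=(-1)^{(2g-(p+q))(2g-(p+q)-1)/2}\,\alpha_{p,q}.$$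
   Context: For a lattice (finitely generated free abelian group) $M$ write $M_{\mathbb R}=M\otimes_{\mathbb Z}\mathbb R$, $M^*=\mathrm{Hom}(M,\mathbb Z)$. A real torus with integral structure of dimension $g$ is $X=N_{\mathbb R}/\Lambda$, where $N$ is a lattice of rank $g$ and $\Lambda\subset N_{\mathbb R}$ is a second lattice of full rank $g$. Its dual is $\widehat X=\Lambda^*_{\mathbb R}/N^*$ (integral structure given by $\Lambda^*$). Tropical cohomology: $H^{p,q}(X)=\bigwedge^q\Lambda^*\otimes\bigwedge^pN^*$, with cup product $(\alpha\otimes\omega)\smile(\beta\otimes\xi)=(\alpha\wedge\beta)\otimes(\omega\wedge\xi)$; hence $H^{p,q}(\widehat X)=\bigwedge^qN\otimes\bigwedge^p\Lambda$, which is identified (interchanging the tensor factors, without sign) with $\bigwedge^p\Lambda\otimes\bigwedge^qN$. Fix bases $\{\lambda_i\}_{i=1}^g$ of $\Lambda$ and $\{\eta_i\}_{i=1}^g$ of $N$ inducing the same orientation of $N_{\mathbb R}$, with dual bases $\{\lambda_i^*\},\{\eta_i^*\}$. Let $\delta:H^{\bullet,\bullet}(X)\to H^{g,g}(X)\cong\mathbb Z$ be projection to bidegree $(g,g)$ followed by $(\lambda_1^*\wedge\dots\wedge\lambda_g^* )\otimes(\eta_1^*\wedge\dots\wedge\eta_g^* )\mapsto1$. Poincaré duality $H^{p,q}(X)\xrightarrow{\sim}H^{g-p,g-q}(X)^*=\bigwedge^{g-q}\Lambda\otimes\bigwedge^{g-p}N$ sends $x$ to the functional $y\mapsto\delta(y\smile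 x)$. Künneth: $H^{\bullet,\bullet}(X\times\widehat X)=H^{\bullet,\bullet}(X)\otimes H^{\bullet,\bullet}(\widehat X)$, with product $(x\otimes y)\cdot(x'\otimes y')=(-1)^{|x||y'|}(x\smile x')\otimes(y\smile y')$, where $|\cdot|$ is the total degree $p+q$. For the projections $p_1,p_2$ of $X\times\widehat X$ to $X,\widehat X$: $p_1^*(x)=x\otimes1$, $p_{2*}(x\otimes y)=\delta(x)y$. The tropical Poincaré bundle $\mathcal P_X$ on $X\times\widehat X$ has first Chern class the bilinear form $E_X((n_1,\mu_1),(n_2,\mu_2))=-\mu_2(n_1)-\mu_1(n_2)$ on $N_{\mathbb R}\oplus\Lambda^*_{\mathbb R}$, i.e. $E_X=c_1(\mathcal P_X)=-\sum_i\eta_i^*\otimes\eta_i-\sum_i\lambda_i^*\otimes\lambda_i\in(N^*\otimes N)\oplus(\Lambda^*\otimes\Lambda)$, where $\eta_i^*\in H^{1,0}(X)$, $\eta_i\in H^{0,1}(\widehat X)$, $\lambda_i^*\in H^{0,1}(X)$, $\lambda_i\in H^{1,0}(\widehat X)$. The components of $c_1(\mathcal P_X)$ in $\Lambda^*\otimes\Lambda=\mathrm{End}(\Lambda)$ and $N^*\otimes N=\mathrm{End}(N)$ are $\Psi_\Lambda$ and $\Psi_N$. The Fourier--Mukai transform is $F_{E_X}(\alpha)=p_{2*}\big(e^{c_1(\mathcal P_X)}\cdot p_1^*\alpha\big)$ with $e^{c_1(\mathcal P_X)}=\sum_{k\ge0}\frac1{k!}c_1(\mathcal P_X)^k$. 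*)

theory Defs
  imports
    "Jordan_Normal_Form.Determinant"
    "HOL-Computational_Algebra.Group_Closure"
    "HOL-Library.Function_Algebras"
    "HOL-Library.Groups_Big_Fun"
    Complex_Main
begin

definition lattice_basis :: "nat \<Rightarrow> (nat \<Rightarrow> 'v::real_vector) \<Rightarrow> 'v set \<Rightarrow> bool" where
  "lattice_basis g b M \<longleftrightarrow>
     inj_on b {..<g} \<and> independent (b ` {..<g}) \<and>
     M = {\<Sum>i<g. real_of_int (c i) *\<^sub>R b i | c. True}"

definition is_lattice :: "nat \<Rightarrow> 'v::real_vector set \<Rightarrow> bool" where
  "is_lattice g M \<longleftrightarrow> (\<exists>b. lattice_basis g b M)"

text \<open>\<open>N\<^sub>\<real>\<close> is realised as the real span of \<open>N\<close> inside an ambient real vector space.\<close>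

definition real_torus :: "nat \<Rightarrow> 'v::real_vector set \<Rightarrow> 'v set \<Rightarrow> bool" where
  "real_torus g N \<Lambda> \<longleftrightarrow> is_lattice g N \<and> is_lattice g \<Lambda> \<and> \<Lambda> \<subseteq> span N"

definition same_orientation :: "nat \<Rightarrow> (nat \<Rightarrow> 'v::real_vector) \<Rightarrow> (nat \<Rightarrow> 'v) \<Rightarrow> bool" where
  "same_orientation g b b' \<longleftrightarrow>
     (\<exists>A \<in> carrier_mat g g. (\<forall>j<g. b' j = (\<Sum>i<g. A $$ (i, j) *\<^sub>R b i)) \<and> det A > 0)"

text \<open>\<open>M\<^sup>* = Hom(M, \<int>)\<close>; homomorphisms are extended by 0 outside \<open>M\<close>, so that they are
  determined by their values on \<open>M\<close>.\<close>

definition dual :: "'a::ab_group_add set \<Rightarrow> ('a \<Rightarrow> int) set" where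
  "dual M = {f. (\<forall>x\<in>M. \<forall>y\<in>M. f (x + y) = f x + f y) \<and> (\<forall>x. x \<notin> M \<longrightarrow> f x = 0)}"

definition dual_basis :: "nat \<Rightarrow> (nat \<Rightarrow> 'v::real_vector) \<Rightarrow> 'v set \<Rightarrow> nat \<Rightarrow> 'v \<Rightarrow> int" where
  "dual_basis g b M i = (THE f. f \<in> dual M \<and> (\<forall>j<g. f (b j) = (if j = i then 1 else 0)))"

text \<open>The canonical map \<open>M \<rightarrow> M\<^sup>*\<^sup>*\<close>.\<close>

definition bidual :: "'a::ab_group_add set \<Rightarrow> 'a \<Rightarrow> ('a \<Rightarrow> int) \<Rightarrow> int" where
  "bidual M v = (\<lambda>\<mu>. if \<mu> \<in> dual M then \<mu> v else 0)"

text \<open>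
  \<open>\<And>\<^sup>k M\<^sup>*\<close> is realised inside the functions on \<open>k\<close>-tuples of \<open>M\<close>: it is generated by the products
  \<open>\<mu>\<^sub>1 \<and> \<dots> \<and> \<mu>\<^sub>k\<close>, where the wedge product is the (integral) shuffle product, so that
  \<open>(\<mu>\<^sub>1 \<and> \<dots> \<and> \<mu>\<^sub>k)(v\<^sub>1, \<dots>, v\<^sub>k) = det (\<mu>\<^sub>i(v\<^sub>j))\<close>. The canonical map from the exterior power is
  injective because \<open>M\<close> is free of finite rank. A function on lists of arbitrary length carries
  all degrees at once, its degree \<open>k\<close> part being its restriction to lists of length \<open>k\<close>.
\<close>

type_synonym 'a form = "'a list \<Rightarrow> rat"

definition one_form :: "('a \<Rightarrow> int) \<Rightarrow> 'a form" where
  "one_form \<mu> = (\<lambda>vs. if length vs = 1 then of_int (\<mu> (hd vs)) else 0)"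

definition unit_form :: "'a form" where
  "unit_form = (\<lambda>vs. if vs = [] then 1 else 0)"

text \<open>The sign of the permutation of \<open>{..<n}\<close> listing \<open>S\<close> before its complement, both increasingly.\<close>

definition shuffle_sign :: "nat \<Rightarrow> nat set \<Rightarrow> rat" where
  "shuffle_sign n S = (-1) ^ card {(i, j). i \<in> S \<and> j \<in> {..<n} - S \<and> j < i}"

definition wedge :: "'a form \<Rightarrow> 'a form \<Rightarrow> 'a form" where
  "wedge \<alpha> \<beta> = (\<lambda>vs. \<Sum>S\<in>Pow {..<length vs}.
     shuffle_sign (length vs) S * \<alpha> (nths vs S) * \<beta> (nths vs (- S)))"

definition wedge_list :: "('a \<Rightarrow> int) list \<Rightarrow> 'a form" where
  "wedge_list \<mu>s = foldr (\<lambda>\<mu>. wedge (one_form \<mu>)) \<mu>s unit_form"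

text \<open>Elements of \<open>\<And>A\<^sup>* \<otimes> \<And>B\<^sup>*\<close> are functions of a list in \<open>A\<close> and a list in \<open>B\<close>.\<close>

type_synonym ('a, 'b) biform = "'a list \<Rightarrow> 'b list \<Rightarrow> rat"

definition tens :: "'a form \<Rightarrow> 'b form \<Rightarrow> ('a, 'b) biform" (infixr "\<otimes>\<^sub>f" 75) where
  "\<alpha> \<otimes>\<^sub>f \<omega> = (\<lambda>as bs. \<alpha> as * \<omega> bs)"

text \<open>The group \<open>\<And>\<^sup>q A\<^sup>* \<otimes> \<And>\<^sup>p B\<^sup>*\<close>.\<close>

definition ext_tensor ::
  "'a::ab_group_add set \<Rightarrow> 'b::ab_group_add set \<Rightarrow> nat \<Rightarrow> nat \<Rightarrow> ('a, 'b) biform set" where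
  "ext_tensor A B q p = group_closure
     {wedge_list \<mu>s \<otimes>\<^sub>f wedge_list \<nu>s | \<mu>s \<nu>s.
        \<mu>s \<in> lists (dual A) \<and> length \<mu>s = q \<and> \<nu>s \<in> lists (dual B) \<and> length \<nu>s = p}"

text \<open>
  \<open>H\<^sup>p\<^sup>,\<^sup>q(X) = \<And>\<^sup>q\<Lambda>\<^sup>* \<otimes> \<And>\<^sup>pN\<^sup>*\<close> for \<open>X = N\<^sub>\<real>/\<Lambda>\<close>. Values are taken in \<open>\<rat>\<close>, so that integral and rational
  classes live in the same type. The dual torus has integral structure \<open>\<Lambda>\<^sup>*\<close> and period lattice
  \<open>N\<^sup>*\<close>, so that \<open>H\<^sup>p\<^sup>,\<^sup>q\<close> of it is \<open>trop_coh (dual \<Lambda>) (dual N) p q\<close>: functions of \<open>q\<close> elements of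
  \<open>N\<^sup>*\<close> and \<open>p\<close> elements of \<open>\<Lambda>\<^sup>*\<close>.
\<close>

definition trop_coh ::
  "'b::ab_group_add set \<Rightarrow> 'a::ab_group_add set \<Rightarrow> nat \<Rightarrow> nat \<Rightarrow> ('a, 'b) biform set" where
  "trop_coh N \<Lambda> p q = ext_tensor \<Lambda> N q p"

definition unit_class :: "('a, 'b) biform" where
  "unit_class = unit_form \<otimes>\<^sub>f unit_form"

text \<open>The bilinear extension of
  \<open>(\<alpha> \<otimes> \<omega>) \<smile> (\<beta> \<otimes> \<xi>) = (\<alpha> \<and> \<beta>) \<otimes> (\<omega> \<and> \<xi>)\<close>, see \<open>cup_tens\<close>.\<close>

definition cup :: "('a, 'b) biform \<Rightarrow> ('a, 'b) biform \<Rightarrow> ('a, 'b) biform" (infixl "\<smile>" 70) where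
  "x \<smile> y = (\<lambda>as bs. \<Sum>S\<in>Pow {..<length as}. \<Sum>T\<in>Pow {..<length bs}.
     shuffle_sign (length as) S * shuffle_sign (length bs) T *
     x (nths as S) (nths bs T) * y (nths as (- S)) (nths bs (- T)))"

lemma cup_tens: "(\<alpha> \<otimes>\<^sub>f \<omega>) \<smile> (\<beta> \<otimes>\<^sub>f \<xi>) = wedge \<alpha> \<beta> \<otimes>\<^sub>f wedge \<omega> \<xi>"
  by (simp add: fun_eq_iff cup_def tens_def wedge_def sum_product mult_ac)

definition bideg_proj :: "nat \<Rightarrow> nat \<Rightarrow> ('a, 'b) biform \<Rightarrow> ('a, 'b) biform" where
  "bideg_proj p q x = (\<lambda>as bs. if length as = q \<and> length bs = p then x as bs else 0)"

definition top_class ::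
  "nat \<Rightarrow> 'v::real_vector set \<Rightarrow> 'v set \<Rightarrow> (nat \<Rightarrow> 'v) \<Rightarrow> (nat \<Rightarrow> 'v) \<Rightarrow> ('v, 'v) biform" where
  "top_class g N \<Lambda> eta lam =
     wedge_list (map (dual_basis g lam \<Lambda>) [0..<g]) \<otimes>\<^sub>f wedge_list (map (dual_basis g eta N) [0..<g])"

definition delta ::
  "nat \<Rightarrow> 'v::real_vector set \<Rightarrow> 'v set \<Rightarrow> (nat \<Rightarrow> 'v) \<Rightarrow> (nat \<Rightarrow> 'v) \<Rightarrow> ('v, 'v) biform \<Rightarrow> rat" where
  "delta g N \<Lambda> eta lam x =
     (THE c. bideg_proj g g x = (\<lambda>as bs. c * top_class g N \<Lambda> eta lam as bs))"

text \<open>An element of \<open>H(X) \<otimes> H(Y)\<close>, where \<open>Y\<close> is the dual torus of \<open>X\<close>, is a function of four lists, with entries in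
  \<open>\<Lambda>\<close>, \<open>N\<close>, \<open>N\<^sup>*\<close>, \<open>\<Lambda>\<^sup>*\<close> respectively.\<close>

type_synonym ('a, 'b, 'c, 'd) quadform = "'a list \<Rightarrow> 'b list \<Rightarrow> 'c list \<Rightarrow> 'd list \<Rightarrow> rat"

definition ktens :: "('a, 'b) biform \<Rightarrow> ('c, 'd) biform \<Rightarrow> ('a, 'b, 'c, 'd) quadform"
    (infixr "\<otimes>\<^sub>K" 65) where
  "x \<otimes>\<^sub>K y = (\<lambda>as bs cs ds. x as bs * y cs ds)"

text \<open>The bilinear extension of
  \<open>(x \<otimes> y) \<cdot> (x' \<otimes> y') = (-1)^(|x||y'|) (x \<smile> x') \<otimes> (y \<smile> y')\<close>, see \<open>kprod_ktens\<close>.\<close>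

definition kprod :: "('a, 'b, 'c, 'd) quadform \<Rightarrow> ('a, 'b, 'c, 'd) quadform \<Rightarrow>
    ('a, 'b, 'c, 'd) quadform" where
  "kprod Z W = (\<lambda>as bs cs ds.
     \<Sum>S\<in>Pow {..<length as}. \<Sum>T\<in>Pow {..<length bs}.
     \<Sum>U\<in>Pow {..<length cs}. \<Sum>V\<in>Pow {..<length ds}.
       shuffle_sign (length as) S * shuffle_sign (length bs) T *
       shuffle_sign (length cs) U * shuffle_sign (length ds) V *
       (-1) ^ ((length (nths as S) + length (nths bs T)) *
               (length (nths cs (- U)) + length (nths ds (- V)))) *
       Z (nths as S) (nths bs T) (nths cs U) (nths ds V) *
       W (nths as (- S)) (nths bs (- T)) (nths cs (- U)) (nths ds (- V)))"

lemma kprod_ktens: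
  assumes x: "\<And>as bs. length as + length bs \<noteq> m \<Longrightarrow> x as bs = 0"
    and y': "\<And>cs ds. length cs + length ds \<noteq> n \<Longrightarrow> y' cs ds = 0"
  shows "kprod (x \<otimes>\<^sub>K y) (x' \<otimes>\<^sub>K y') = (\<lambda>as bs cs ds. (-1) ^ (m * n) * ((x \<smile> x') \<otimes>\<^sub>K (y \<smile> y')) as bs cs ds)"
proof (intro ext)
  fix as :: "'a list" and bs :: "'b list" and cs :: "'c list" and ds :: "'d list"
  let ?s = "shuffle_sign (length as)" and ?t = "shuffle_sign (length bs)"
  let ?u = "shuffle_sign (length cs)" and ?v = "shuffle_sign (length ds)"
  have sgn: "(-1) ^ ((length a + length b) * (length c + length d)) * (x a b * y' c d)
      = (-1) ^ (m * n) * (x a b * y' c d)" for a :: "'a list" and b :: "'b list"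
      and c :: "'c list" and d :: "'d list"
    using x[of a b] y'[of c d] by fastforce
  have "kprod (x \<otimes>\<^sub>K y) (x' \<otimes>\<^sub>K y') as bs cs ds =
     (\<Sum>S\<in>Pow {..<length as}. \<Sum>T\<in>Pow {..<length bs}.
      \<Sum>U\<in>Pow {..<length cs}. \<Sum>V\<in>Pow {..<length ds}.
       ?s S * ?t T * ?u U * ?v V * y (nths cs U) (nths ds V) * x' (nths as (- S)) (nths bs (- T)) *
       ((-1) ^ ((length (nths as S) + length (nths bs T)) *
               (length (nths cs (- U)) + length (nths ds (- V)))) *
        (x (nths as S) (nths bs T) * y' (nths cs (- U)) (nths ds (- V)))))"
    unfolding kprod_def ktens_def by (simp only: mult_ac)
  also have "\<dots> = (-1) ^ (m * n) * ((x \<smile> x') as bs * (y \<smile> y') cs ds)"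
    unfolding sgn cup_def sum_distrib_right unfolding sum_distrib_left by (simp only: mult_ac)
  finally show "kprod (x \<otimes>\<^sub>K y) (x' \<otimes>\<^sub>K y') as bs cs ds =
      (-1) ^ (m * n) * ((x \<smile> x') \<otimes>\<^sub>K (y \<smile> y')) as bs cs ds"
    by (simp add: ktens_def)
qed

primrec kpower :: "('a, 'b, 'c, 'd) quadform \<Rightarrow> nat \<Rightarrow> ('a, 'b, 'c, 'd) quadform" where
  "kpower Z 0 = unit_class \<otimes>\<^sub>K unit_class"
| "kpower Z (Suc k) = kprod Z (kpower Z k)"

text \<open>For \<open>Z\<close> without component of degree 0, as is the case for a Chern class, only finitely many
  powers contribute to the value on given arguments.\<close>

definition kexp :: "('a, 'b, 'c, 'd) quadform \<Rightarrow> ('a, 'b, 'c, 'd) quadform" where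
  "kexp Z = (\<lambda>as bs cs ds. Sum_any (\<lambda>k. 1 / fact k * kpower Z k as bs cs ds))"

definition pullback1 :: "('a, 'b) biform \<Rightarrow> ('a, 'b, 'c, 'd) quadform" where
  "pullback1 x = x \<otimes>\<^sub>K unit_class"

text \<open>The linear extension of \<open>x \<otimes> y \<mapsto> \<delta>(x) y\<close>.\<close>

definition pushforward2 ::
  "nat \<Rightarrow> 'v::real_vector set \<Rightarrow> 'v set \<Rightarrow> (nat \<Rightarrow> 'v) \<Rightarrow> (nat \<Rightarrow> 'v) \<Rightarrow>
   ('v, 'v, 'c, 'd) quadform \<Rightarrow> ('c, 'd) biform" where
  "pushforward2 g N \<Lambda> eta lam Z = (\<lambda>cs ds. delta g N \<Lambda> eta lam (\<lambda>as bs. Z as bs cs ds))"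

definition c1_poincare ::
  "nat \<Rightarrow> 'v::real_vector set \<Rightarrow> 'v set \<Rightarrow> (nat \<Rightarrow> 'v) \<Rightarrow> (nat \<Rightarrow> 'v) \<Rightarrow>
   ('v, 'v, 'v \<Rightarrow> int, 'v \<Rightarrow> int) quadform" where
  "c1_poincare g N \<Lambda> eta lam =
     - (\<Sum>i<g. (unit_form \<otimes>\<^sub>f one_form (dual_basis g eta N i)) \<otimes>\<^sub>K
               (one_form (bidual N (eta i)) \<otimes>\<^sub>f unit_form))
     - (\<Sum>i<g. (one_form (dual_basis g lam \<Lambda> i) \<otimes>\<^sub>f unit_form) \<otimes>\<^sub>K
               (unit_form \<otimes>\<^sub>f one_form (bidual \<Lambda> (lam i))))"

definition fourier_mukai ::
  "nat \<Rightarrow> 'v::real_vector set \<Rightarrow> 'v set \<Rightarrow> (nat \<Rightarrow> 'v) \<Rightarrow> (nat \<Rightarrow> 'v) \<Rightarrow>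
   ('v, 'v) biform \<Rightarrow> ('v \<Rightarrow> int, 'v \<Rightarrow> int) biform" where
  "fourier_mukai g N \<Lambda> eta lam x =
     pushforward2 g N \<Lambda> eta lam (kprod (kexp (c1_poincare g N \<Lambda> eta lam)) (pullback1 x))"

text \<open>The components of a class in \<open>\<Lambda>\<^sup>* \<otimes> \<Lambda> = End \<Lambda>\<close> and \<open>N\<^sup>* \<otimes> N = End N\<close>: the tensor \<open>\<mu> \<otimes> u\<close> is the
  endomorphism \<open>v \<mapsto> \<mu>(v) u\<close>, and it is the biform \<open>(v, \<mu>') \<mapsto> \<mu>(v) \<mu>'(u)\<close>.\<close>

definition Psi_Lambda ::
  "'v::real_vector set \<Rightarrow> ('v, 'v, 'v \<Rightarrow> int, 'v \<Rightarrow> int) quadform \<Rightarrow> 'v \<Rightarrow> 'v" where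
  "Psi_Lambda \<Lambda> Z v = (THE u. u \<in> \<Lambda> \<and> (\<forall>\<mu> \<in> dual \<Lambda>. of_int (\<mu> u) = Z [v] [] [] [\<mu>]))"

definition Psi_N ::
  "'v::real_vector set \<Rightarrow> ('v, 'v, 'v \<Rightarrow> int, 'v \<Rightarrow> int) quadform \<Rightarrow> 'v \<Rightarrow> 'v" where
  "Psi_N N Z v = (THE u. u \<in> N \<and> (\<forall>\<nu> \<in> dual N. of_int (\<nu> u) = Z [] [v] [\<nu>] []))"

text \<open>The identification of functionals on \<open>\<And>\<^sup>q A\<^sup>* \<otimes> \<And>\<^sup>p B\<^sup>*\<close> with elements of
  \<open>\<And>\<^sup>q A \<otimes> \<And>\<^sup>p B\<close> (in which \<open>A = A\<^sup>*\<^sup>*\<close>, \<open>B = B\<^sup>*\<^sup>*\<close>), by the pairing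
  \<open>\<langle>\<mu>\<^sub>1 \<and> \<dots> \<and> \<mu>\<^sub>k, v\<^sub>1 \<and> \<dots> \<and> v\<^sub>k\<rangle> = det (\<mu>\<^sub>i(v\<^sub>j))\<close>, which is the value of the form
  \<open>v\<^sub>1 \<and> \<dots> \<and> v\<^sub>k\<close> on \<open>(\<mu>\<^sub>1, \<dots>, \<mu>\<^sub>k)\<close>.\<close>

definition element_of_functional ::
  "'a::ab_group_add set \<Rightarrow> 'b::ab_group_add set \<Rightarrow> nat \<Rightarrow> nat \<Rightarrow>
   (('a, 'b) biform \<Rightarrow> rat) \<Rightarrow> ('a \<Rightarrow> int, 'b \<Rightarrow> int) biform" where
  "element_of_functional A B q p \<phi> =
     (THE z. z \<in> ext_tensor (dual A) (dual B) q p \<and>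
        (\<forall>\<mu>s \<in> lists (dual A). \<forall>\<nu>s \<in> lists (dual B). length \<mu>s = q \<longrightarrow> length \<nu>s = p \<longrightarrow>
           z \<mu>s \<nu>s = \<phi> (wedge_list \<mu>s \<otimes>\<^sub>f wedge_list \<nu>s)))"

definition poincare_duality ::
  "nat \<Rightarrow> 'v::real_vector set \<Rightarrow> 'v set \<Rightarrow> (nat \<Rightarrow> 'v) \<Rightarrow> (nat \<Rightarrow> 'v) \<Rightarrow> nat \<Rightarrow> nat \<Rightarrow>
   ('v, 'v) biform \<Rightarrow> ('v \<Rightarrow> int, 'v \<Rightarrow> int) biform" where
  "poincare_duality g N \<Lambda> eta lam p q x =
     element_of_functional \<Lambda> N (g - q) (g - p) (\<lambda>y. delta g N \<Lambda> eta lam (y \<smile> x))"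

text \<open>The map \<open>\<And>f \<otimes> \<And>h\<close> on \<open>\<And>A \<otimes> \<And>B\<close> induced by \<open>f \<in> End A\<close>, \<open>h \<in> End B\<close>: as a form on \<open>A\<^sup>*\<close>,
  \<open>f v\<^sub>1 \<and> \<dots> \<and> f v\<^sub>k\<close> is \<open>v\<^sub>1 \<and> \<dots> \<and> v\<^sub>k\<close> precomposed with the transpose \<open>\<mu> \<mapsto> \<mu> \<circ> f\<close>.\<close>

definition transpose_map :: "'a set \<Rightarrow> ('a \<Rightarrow> 'a) \<Rightarrow> ('a \<Rightarrow> int) \<Rightarrow> ('a \<Rightarrow> int)" where
  "transpose_map A f \<mu> = (\<lambda>v. if v \<in> A then \<mu> (f v) else 0)"

definition induced_map ::
  "'a::ab_group_add set \<Rightarrow> 'b::ab_group_add set \<Rightarrow> ('a \<Rightarrow> 'a) \<Rightarrow> ('b \<Rightarrow> 'b) \<Rightarrow>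
   ('a \<Rightarrow> int, 'b \<Rightarrow> int) biform \<Rightarrow> ('a \<Rightarrow> int, 'b \<Rightarrow> int) biform" where
  "induced_map A B f h z = (\<lambda>\<mu>s \<nu>s.
     if \<mu>s \<in> lists (dual A) \<and> \<nu>s \<in> lists (dual B)
     then z (map (transpose_map A f) \<mu>s) (map (transpose_map B h) \<nu>s) else 0)"

definition swap_factors :: "('a, 'b) biform \<Rightarrow> ('b, 'a) biform" where
  "swap_factors z = (\<lambda>bs as. z as bs)"

text \<open>For \<open>p > g\<close> or \<open>q > g\<close> the source \<open>H\<^sup>p\<^sup>,\<^sup>q(X)\<close> is zero, and the truncation in \<open>g - p\<close>, \<open>g - q\<close> is
  harmless.\<close>

definition alpha_map ::
  "nat \<Rightarrow> 'v::real_vector set \<Rightarrow> 'v set \<Rightarrow> (nat \<Rightarrow> 'v) \<Rightarrow> (nat \<Rightarrow> 'v) \<Rightarrow> nat \<Rightarrow> nat \<Rightarrow>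
   ('v, 'v) biform \<Rightarrow> ('v \<Rightarrow> int, 'v \<Rightarrow> int) biform" where
  "alpha_map g N \<Lambda> eta lam p q x =
     swap_factors (induced_map \<Lambda> N
       (Psi_Lambda \<Lambda> (c1_poincare g N \<Lambda> eta lam)) (Psi_N N (c1_poincare g N \<Lambda> eta lam))
       (poincare_duality g N \<Lambda> eta lam p q x))"

end

theory Submission
  imports Defs
begin

text \<open>
  By duality of bases \<open>c\<^sub>1(P)\<close> is, up to sign, the evaluation pairing of \<open>\<Lambda>\<close> with \<open>\<Lambda>\<^sup>*\<close> plus that of
  \<open>N\<close> with \<open>N\<^sup>*\<close>. Laplace expansion shows that the value of \<open>exp c\<^sub>1(P)\<close> on tuples of vectors and
  functionals is the product of the two determinants of all pairings, with sign \<open>(-1)^(m(m-1)/2)\<close>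
  in total degree \<open>m\<close>. Regarded as forms in the vectors these determinants are wedge products of
  the negated functionals, so the transform of \<open>x\<close> takes functionals \<open>\<nu>\<^sub>i\<close> of \<open>N\<close> and \<open>\<mu>\<^sub>j\<close> of \<open>\<Lambda>\<close> to
  \<open>\<delta>\<close> of (the wedge of the \<open>-\<mu>\<^sub>j\<close>) \<open>\<otimes>\<close> (the wedge of the \<open>-\<nu>\<^sub>i\<close>) \<open>\<smile> x\<close>. This is the Poincare dual of
  \<open>x\<close> precomposed with the transposes of \<open>\<Psi>\<^sub>\<Lambda> = -id\<close> and \<open>\<Psi>\<^sub>N = -id\<close>, and it vanishes unless
  \<open>m = 2g - (p + q)\<close>.
\<close>

subsection \<open>Signed sums over shuffles\<close>

lemma sum_Pow_lessThan_Suc: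
  fixes h :: "nat set \<Rightarrow> 'a::comm_monoid_add"
  shows "(\<Sum>S\<in>Pow {..<Suc n}. h S) =
    (\<Sum>S\<in>Pow {..<n}. h (insert 0 (Suc ` S))) + (\<Sum>S\<in>Pow {..<n}. h (Suc ` S))"
proof -
  have eq: "Pow {..<Suc n} = insert 0 ` (image Suc ` Pow {..<n}) \<union> image Suc ` Pow {..<n}"
    unfolding lessThan_Suc_eq_insert_0 Pow_insert by (simp add: image_Pow_surj Un_commute)
  have inj: "inj_on (image Suc) (Pow {..<n})"
    by (rule inj_onI) (simp add: inj_image_eq_iff)
  have inj0: "inj_on (insert 0) (image Suc ` Pow {..<n})"
    by (rule inj_onI) (metis (no_types, lifting) imageE insert_ident nat.distinct(1))
  have "insert 0 ` (image Suc ` Pow {..<n}) \<inter> image Suc ` Pow {..<n} = {}"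
    by fastforce
  then show ?thesis
    unfolding eq using inj inj0 by (subst sum.union_disjoint) (auto simp: sum.reindex)
qed

lemma card_inversions_image_Suc:
  "card {(i, j). i \<in> Suc ` S \<and> j \<in> Suc ` T \<and> j < i} = card {(i, j). i \<in> S \<and> j \<in> T \<and> j < i}"
proof -
  have "{(i, j). i \<in> Suc ` S \<and> j \<in> Suc ` T \<and> j < i} = map_prod Suc Suc ` {(i, j). i \<in> S \<and> j \<in> T \<and> j < i}"
    by (auto simp: image_iff)
  moreover have "inj (map_prod Suc Suc)"
    by (simp add: prod.inj_map)
  ultimately show ?thesis
    by (simp add: card_image inj_on_subset)
qed

lemma shuffle_sign_insert_0:
  "shuffle_sign (Suc n) (insert 0 (Suc ` S)) = shuffle_sign n S"
proof -
  have "{(i, j). i \<in> insert 0 (Suc ` S) \<and> j \<in> {..<Suc n} - insert 0 (Suc ` S) \<and> j < i}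
      = {(i, j). i \<in> Suc ` S \<and> j \<in> Suc ` ({..<n} - S) \<and> j < i}"
    unfolding lessThan_Suc_eq_insert_0 by auto
  then show ?thesis
    unfolding shuffle_sign_def by (simp only: card_inversions_image_Suc)
qed

lemma shuffle_sign_image_Suc:
  assumes "finite S"
  shows "shuffle_sign (Suc n) (Suc ` S) = (-1) ^ card S * shuffle_sign n S"
proof -
  let ?I = "{(i, j). i \<in> Suc ` S \<and> j \<in> Suc ` ({..<n} - S) \<and> j < i}"
  have eq: "{(i, j). i \<in> Suc ` S \<and> j \<in> {..<Suc n} - Suc ` S \<and> j < i} = Suc ` S \<times> {0} \<union> ?I"
    unfolding lessThan_Suc_eq_insert_0 by auto
  have "finite ?I"
    by (rule finite_subset[of _ "Suc ` S \<times> Suc ` {..<n}"]) (use assms in auto)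
  then have "card (Suc ` S \<times> {0} \<union> ?I) = card S + card {(i, j). i \<in> S \<and> j \<in> {..<n} - S \<and> j < i}"
    by (subst card_Un_disjoint)
      (use assms in \<open>auto simp: card_cartesian_product card_image card_inversions_image_Suc
        simp del: Diff_iff\<close>)
  then show ?thesis
    unfolding shuffle_sign_def eq by (simp add: power_add)
qed

definition shuffle_sum :: "('a list \<Rightarrow> 'a list \<Rightarrow> rat) \<Rightarrow> 'a list \<Rightarrow> rat" where
  "shuffle_sum h xs =
    (\<Sum>S\<in>Pow {..<length xs}. shuffle_sign (length xs) S * h (nths xs S) (nths xs (- S)))"

lemma shuffle_sum_Nil [simp]: "shuffle_sum h [] = h [] []"
  by (simp add: shuffle_sum_def shuffle_sign_def)

lemma shuffle_sum_Cons [simp]: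
  "shuffle_sum h (x # xs) =
    shuffle_sum (\<lambda>us ws. h (x # us) ws) xs + shuffle_sum (\<lambda>us ws. (-1) ^ length us * h us (x # ws)) xs"
proof -
  have preimage_Suc: "{j. Suc j \<in> insert 0 (Suc ` S)} = S" "{j. Suc j \<in> Suc ` S} = S"
    "{j. Suc j \<in> - insert 0 (Suc ` S)} = - S" "{j. Suc j \<in> - Suc ` S} = - S" for S
    by auto
  have card_eq: "card S = length (nths xs S)" if "S \<subseteq> {..<length xs}" for S
    unfolding length_nths using that by (intro arg_cong[of _ _ card]) auto
  show ?thesis
    unfolding shuffle_sum_def length_Cons sum_Pow_lessThan_Suc
    by (intro arg_cong2[of _ _ _ _ "(+)"] sum.cong refl)
      (auto simp: nths_Cons preimage_Suc[simplified] shuffle_sign_insert_0 shuffle_sign_image_Suc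
        card_eq finite_subset)
qed

lemma shuffle_sum_0 [simp]: "shuffle_sum (\<lambda>us ws. 0) xs = 0"
  by (simp add: shuffle_sum_def)

lemma shuffle_sum_add:
  "shuffle_sum (\<lambda>us ws. h us ws + h' us ws) xs = shuffle_sum h xs + shuffle_sum h' xs"
  by (simp add: shuffle_sum_def sum.distrib algebra_simps)

lemma shuffle_sum_diff:
  "shuffle_sum (\<lambda>us ws. h us ws - h' us ws) xs = shuffle_sum h xs - shuffle_sum h' xs"
  by (simp add: shuffle_sum_def sum_subtractf algebra_simps)

lemma shuffle_sum_mult_left: "shuffle_sum (\<lambda>us ws. c * h us ws) xs = c * shuffle_sum h xs"
  unfolding shuffle_sum_def sum_distrib_left by (simp only: mult_ac)

lemma shuffle_sum_mult_right: "shuffle_sum (\<lambda>us ws. h us ws * c) xs = shuffle_sum h xs * c"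
  using shuffle_sum_mult_left[of c h] by (simp only: mult.commute)

lemma shuffle_sum_swap:
  "shuffle_sum (\<lambda>us ws. shuffle_sum (h us ws) ys) xs =
    shuffle_sum (\<lambda>us' ws'. shuffle_sum (\<lambda>us ws. h us ws us' ws') xs) ys"
  unfolding shuffle_sum_def sum_distrib_left by (subst sum.swap) (simp only: mult_ac)

lemma shuffle_sum_cong:
  assumes "\<And>us ws. length us + length ws = length xs \<Longrightarrow> h us ws = h' us ws"
  shows "shuffle_sum h xs = shuffle_sum h' xs"
  using assms
proof (induction xs arbitrary: h h')
  case (Cons x xs)
  show ?case
    unfolding shuffle_sum_Cons
    by (intro arg_cong2[of _ _ _ _ "(+)"] Cons.IH) (simp_all add: Cons.prems)
qed simp

lemma shuffle_sum_unit_left: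
  assumes "\<And>us ws. us \<noteq> [] \<Longrightarrow> h us ws = 0"
  shows "shuffle_sum h xs = h [] xs"
  using assms
proof (induction xs arbitrary: h)
  case (Cons x xs)
  then show ?case
    using Cons.IH[of "\<lambda>us ws. (-1) ^ length us * h us (x # ws)"] by simp
qed simp

lemma shuffle_sum_unit_right:
  assumes "\<And>us ws. ws \<noteq> [] \<Longrightarrow> h us ws = 0"
  shows "shuffle_sum h xs = h xs []"
  using assms
proof (induction xs arbitrary: h)
  case (Cons x xs)
  then show ?case
    using Cons.IH[of "\<lambda>us. h (x # us)"] by simp
qed simp

lemma nths_Cons_Compl_singleton:
  "nths (x # xs) (- {0}) = xs" "nths (x # xs) (- {Suc i}) = x # nths xs (- {i})"
proof -
  have "{j. Suc j \<in> - {0}} = UNIV" "{j. Suc j \<in> - {Suc i}} = - {i}"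
    by auto
  then show "nths (x # xs) (- {0}) = xs" "nths (x # xs) (- {Suc i}) = x # nths xs (- {i})"
    by (simp_all add: nths_Cons nths_all)
qed

lemma shuffle_sum_singleton_left:
  assumes "\<And>us ws. length us \<noteq> 1 \<Longrightarrow> h us ws = 0"
  shows "shuffle_sum h xs = (\<Sum>i<length xs. (-1) ^ i * h [xs ! i] (nths xs (- {i})))"
  using assms
proof (induction xs arbitrary: h)
  case (Cons x xs)
  have "shuffle_sum (\<lambda>us ws. h (x # us) ws) xs = h [x] xs"
    by (rule shuffle_sum_unit_left) (simp add: Cons.prems)
  moreover have "shuffle_sum (\<lambda>us ws. (-1) ^ length us * h us (x # ws)) xs =
      (\<Sum>i<length xs. (-1) ^ Suc i * h [xs ! i] (x # nths xs (- {i})))"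
    using Cons.IH[of "\<lambda>us ws. (-1) ^ length us * h us (x # ws)"] Cons.prems by simp
  ultimately show ?case
    by (simp add: sum.lessThan_Suc_shift nths_Cons_Compl_singleton del: sum.lessThan_Suc)
qed simp

lemma shuffle_sum_assoc:
  "shuffle_sum (\<lambda>us ws. shuffle_sum (\<lambda>as bs. h as bs ws) us) xs =
    shuffle_sum (\<lambda>us ws. shuffle_sum (\<lambda>as bs. h us as bs) ws) xs"
proof (induction xs arbitrary: h)
  case (Cons x xs)
  have sign: "(-1) ^ length us * shuffle_sum (\<lambda>as bs. h as bs (x # ws)) us =
      shuffle_sum (\<lambda>as bs. (-1) ^ (length as + length bs) * h as bs (x # ws)) us" for us ws
    unfolding shuffle_sum_mult_left[symmetric] by (rule shuffle_sum_cong) simp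
  show ?case
    unfolding shuffle_sum_Cons sign
    unfolding shuffle_sum_add distrib_left shuffle_sum_mult_left[symmetric] Cons.IH power_add
    by (simp only: mult.assoc add.assoc)
qed simp

subsection \<open>Wedge and cup products\<close>

lemma wedge_eq_shuffle_sum: "wedge \<alpha> \<beta> = shuffle_sum (\<lambda>us ws. \<alpha> us * \<beta> ws)"
  by (simp add: fun_eq_iff wedge_def shuffle_sum_def mult.assoc)

lemma wedge_assoc: "wedge (wedge \<alpha> \<beta>) \<gamma> = wedge \<alpha> (wedge \<beta> \<gamma>)"
proof
  fix vs
  show "wedge (wedge \<alpha> \<beta>) \<gamma> vs = wedge \<alpha> (wedge \<beta> \<gamma>) vs"
    using shuffle_sum_assoc[of "\<lambda>as bs cs. \<alpha> as * \<beta> bs * \<gamma> cs" vs]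
    by (simp add: wedge_eq_shuffle_sum mult.assoc flip: shuffle_sum_mult_left shuffle_sum_mult_right)
qed

lemma wedge_unit_form_left: "wedge unit_form \<alpha> = \<alpha>"
  by (simp add: fun_eq_iff wedge_eq_shuffle_sum shuffle_sum_unit_left unit_form_def)

lemma wedge_list_append: "wedge_list (\<mu>s @ \<nu>s) = wedge (wedge_list \<mu>s) (wedge_list \<nu>s)"
  by (induction \<mu>s) (simp_all add: wedge_list_def wedge_unit_form_left wedge_assoc)

lemma wedge_one_form_left:
  "wedge (one_form \<mu>) \<beta> vs = (\<Sum>i<length vs. (-1) ^ i * of_int (\<mu> (vs ! i)) * \<beta> (nths vs (- {i})))"
  unfolding wedge_eq_shuffle_sum
  by (subst shuffle_sum_singleton_left) (simp_all add: one_form_def mult.assoc)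

lemma wedge_list_Ints: "wedge_list \<mu>s vs \<in> \<int>"
  by (induction \<mu>s arbitrary: vs)
    (auto simp: wedge_list_def unit_form_def wedge_one_form_left intro!: Ints_mult)

lemma cup_eq_shuffle_sum:
  "(x \<smile> y) as bs = shuffle_sum (\<lambda>a a'. shuffle_sum (\<lambda>b b'. x a b * y a' b') bs) as"
  unfolding cup_def shuffle_sum_def sum_distrib_left by (simp only: mult_ac)

subsection \<open>Determinants of pairings\<close>

definition pairing_det :: "('a \<Rightarrow> 'b \<Rightarrow> rat) \<Rightarrow> 'a list \<Rightarrow> 'b list \<Rightarrow> rat" where
  "pairing_det P as bs = (if length as = length bs
     then det (mat (length as) (length as) (\<lambda>(i, j). P (as ! i) (bs ! j))) else 0)"

lemma pairing_det_Nil [simp]: "pairing_det P [] [] = 1"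
  by (simp add: pairing_det_def det_def)

lemma pairing_det_length_neq: "length as \<noteq> length bs \<Longrightarrow> pairing_det P as bs = 0"
  by (simp add: pairing_det_def)

lemma pairing_det_cong:
  assumes "\<And>a b. \<lbrakk>a \<in> set as; b \<in> set bs\<rbrakk> \<Longrightarrow> P a b = Q a b"
  shows "pairing_det P as bs = pairing_det Q as bs"
  using assms unfolding pairing_det_def by (auto intro!: arg_cong[of _ _ det] eq_matI)

lemma pairing_det_map_left: "pairing_det P (map f as) bs = pairing_det (\<lambda>a. P (f a)) as bs"
  unfolding pairing_det_def by (auto intro!: arg_cong[of _ _ det] eq_matI)

lemma pairing_det_map_right: "pairing_det P as (map f bs) = pairing_det (\<lambda>a b. P a (f b)) as bs"
  unfolding pairing_det_def by (auto intro!: arg_cong[of _ _ det] eq_matI)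

lemma pairing_det_transpose: "pairing_det P as bs = pairing_det (\<lambda>b a. P a b) bs as"
proof (cases "length as = length bs")
  case True
  let ?A = "mat (length as) (length as) (\<lambda>(i, j). P (as ! i) (bs ! j))"
  have "transpose_mat ?A = mat (length bs) (length bs) (\<lambda>(i, j). P (as ! j) (bs ! i))"
    by (rule eq_matI) (use True in auto)
  then show ?thesis
    using True det_transpose[of ?A "length as"] by (simp add: pairing_det_def)
qed (simp add: pairing_det_def)

lemma pairing_det_mult:
  assumes "length bs = n"
    and P: "\<And>a b. \<lbrakk>a \<in> set as; b \<in> set bs\<rbrakk> \<Longrightarrow> P a b = (\<Sum>k<n. Q a k * R k b)"
  shows "pairing_det P as bs = pairing_det Q as [0..<n] * pairing_det R [0..<n] bs"
proof (cases "length as = n")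
  case True
  let ?Q = "mat n n (\<lambda>(i, k). Q (as ! i) ([0..<n] ! k))"
    and ?R = "mat n n (\<lambda>(k, j). R ([0..<n] ! k) (bs ! j))"
  have "mat n n (\<lambda>(i, j). P (as ! i) (bs ! j)) = ?Q * ?R"
    by (rule eq_matI) (use assms(1) True in \<open>auto simp: P scalar_prod_def lessThan_atLeast0\<close>)
  then show ?thesis
    using assms(1) True by (simp add: pairing_det_def det_mult[of _ n])
qed (simp add: pairing_det_length_neq assms(1))

lemma length_nths_Compl_singleton [simp]: "i < length xs \<Longrightarrow> length (nths xs (- {i})) = length xs - 1"
proof (induction xs arbitrary: i)
  case (Cons x xs)
  then show ?case
    by (cases i) (auto simp: nths_Cons_Compl_singleton)
qed simp

lemma nth_nths_Compl_singleton:
  "i < length xs \<Longrightarrow> k < length xs - 1 \<Longrightarrow> nths xs (- {i}) ! k = xs ! (if k < i then k else Suc k)"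
proof (induction xs arbitrary: i k)
  case (Cons x xs)
  then show ?case
    by (cases i; cases k) (auto simp: nths_Cons_Compl_singleton)
qed simp

lemma pairing_det_expand_column:
  assumes "j < length bs"
  shows "pairing_det P as bs =
    (\<Sum>i<length as. (-1) ^ (i + j) * P (as ! i) (bs ! j) *
      pairing_det P (nths as (- {i})) (nths bs (- {j})))"
proof (cases "length as = length bs")
  case True
  let ?n = "length as"
  let ?A = "mat ?n ?n (\<lambda>(i, j). P (as ! i) (bs ! j))"
  have "mat_delete ?A i j =
      mat (?n - 1) (?n - 1) (\<lambda>(i', j'). P (nths as (- {i}) ! i') (nths bs (- {j}) ! j'))"
    if "i < ?n" for i
    unfolding mat_delete_def
    by (rule eq_matI) (use that assms True in \<open>auto simp: nth_nths_Compl_singleton\<close>)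
  then have "det (mat_delete ?A i j) = pairing_det P (nths as (- {i})) (nths bs (- {j}))"
    if "i < ?n" for i
    using that assms True by (simp add: pairing_det_def)
  moreover have "det ?A = (\<Sum>i<?n. ?A $$ (i, j) * cofactor ?A i j)"
    by (rule laplace_expansion_column) (use assms True in auto)
  ultimately show ?thesis
    using assms True by (simp add: pairing_det_def cofactor_def mult_ac)
next
  case False
  then have "length as - 1 \<noteq> length bs - 1" if "i < length as" for i
    using that assms by linarith
  with False show ?thesis
    using assms by (simp add: pairing_det_length_neq)
qed

lemma sum_pairing_det_minors:
  "(\<Sum>i<length as. \<Sum>j<length bs. (-1) ^ (i + j) * P (as ! i) (bs ! j) *
      pairing_det P (nths as (- {i})) (nths bs (- {j}))) = of_nat (length as) * pairing_det P as bs"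
proof -
  have "(\<Sum>i<length as. \<Sum>j<length bs. (-1) ^ (i + j) * P (as ! i) (bs ! j) *
      pairing_det P (nths as (- {i})) (nths bs (- {j}))) = (\<Sum>j<length bs. pairing_det P as bs)"
    by (subst sum.swap) (rule sum.cong, use pairing_det_expand_column[of _ bs P as] in auto)
  then show ?thesis
    by (auto simp: pairing_det_def)
qed

lemma pairing_det_zero_row:
  assumes "a \<in> set as" and "\<And>b. b \<in> set bs \<Longrightarrow> P a b = 0"
  shows "pairing_det P as bs = 0"
proof -
  obtain i where i: "i < length as" "a = as ! i"
    using assms(1) by (auto simp: in_set_conv_nth)
  show ?thesis
    by (subst pairing_det_transpose, subst pairing_det_expand_column[OF i(1)]) (use assms(2) i in auto)
qed

lemma wedge_list_eq_pairing_det: "wedge_list \<mu>s vs = pairing_det (\<lambda>v \<mu>. of_int (\<mu> v)) vs \<mu>s"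
proof (induction \<mu>s arbitrary: vs)
  case Nil
  show ?case
    by (cases vs) (simp_all add: wedge_list_def unit_form_def pairing_det_length_neq)
next
  case (Cons \<mu> \<mu>s)
  then show ?case
    using pairing_det_expand_column[of 0 "\<mu> # \<mu>s" "\<lambda>v \<mu>. of_int (\<mu> v)" vs]
    by (simp add: wedge_list_def wedge_one_form_left nths_Cons_Compl_singleton)
qed

lemma wedge_list_length_neq: "length vs \<noteq> length \<mu>s \<Longrightarrow> wedge_list \<mu>s vs = 0"
  by (simp add: wedge_list_eq_pairing_det pairing_det_length_neq)

lemma wedge_list_zero_argument:
  assumes "v \<in> set vs" and "\<And>\<mu>. \<mu> \<in> set \<mu>s \<Longrightarrow> \<mu> v = 0"
  shows "wedge_list \<mu>s vs = 0"
  unfolding wedge_list_eq_pairing_det by (rule pairing_det_zero_row[OF assms(1)]) (simp add: assms(2))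

lemma wedge_list_zero_factor:
  assumes "(\<lambda>v. 0) \<in> set \<mu>s"
  shows "wedge_list \<mu>s = 0"
proof
  fix vs
  show "wedge_list \<mu>s vs = 0 vs"
    unfolding wedge_list_eq_pairing_det
    by (subst pairing_det_transpose, subst pairing_det_zero_row[OF assms]) simp_all
qed

subsection \<open>Exponentials of pairing classes\<close>

lemma kprod_eq_shuffle_sum:
  "kprod Z W as bs cs ds =
    shuffle_sum (\<lambda>a a'. shuffle_sum (\<lambda>b b'. shuffle_sum (\<lambda>c c'. shuffle_sum (\<lambda>d d'.
      (-1) ^ ((length a + length b) * (length c' + length d')) * Z a b c d * W a' b' c' d') ds) cs) bs) as"
  unfolding kprod_def shuffle_sum_def sum_distrib_left by (simp only: mult_ac)

lemma kprod_add_left: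
  "kprod (\<lambda>as bs cs ds. Z as bs cs ds + Z' as bs cs ds) W as bs cs ds =
    kprod Z W as bs cs ds + kprod Z' W as bs cs ds"
  by (simp add: kprod_def sum.distrib algebra_simps)

lemma kprod_mult_right:
  "kprod Z (\<lambda>as bs cs ds. r * W as bs cs ds) as bs cs ds = r * kprod Z W as bs cs ds"
  unfolding kprod_def sum_distrib_left by (simp only: mult_ac)

lemma kprod_swap:
  "kprod (\<lambda>as bs cs ds. Z bs as ds cs) (\<lambda>as bs cs ds. W bs as ds cs) as bs cs ds = kprod Z W bs as ds cs"
proof -
  have "kprod (\<lambda>as bs cs ds. Z bs as ds cs) (\<lambda>as bs cs ds. W bs as ds cs) as bs cs ds =
    shuffle_sum (\<lambda>a a'. shuffle_sum (\<lambda>b b'. shuffle_sum (\<lambda>d d'. shuffle_sum (\<lambda>c c'.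
      (-1) ^ ((length b + length a) * (length d' + length c')) * Z b a d c * W b' a' d' c') cs) ds) bs) as"
    unfolding kprod_eq_shuffle_sum by (subst shuffle_sum_swap[of _ ds cs]) (simp only: add.commute)
  then show ?thesis
    unfolding kprod_eq_shuffle_sum by (subst shuffle_sum_swap)
qed

lemma kprod_pullback1:
  "kprod Z (pullback1 x) as bs cs ds = ((\<lambda>as bs. Z as bs cs ds) \<smile> x) as bs"
proof -
  have pullback: "pullback1 x a b c d = (if c = [] \<and> d = [] then x a b else 0)"
    for a :: "'a list" and b :: "'b list" and c :: "'c list" and d :: "'d list"
    by (simp add: pullback1_def ktens_def unit_class_def tens_def unit_form_def)
  show ?thesis
    unfolding kprod_eq_shuffle_sum cup_eq_shuffle_sum pullback
    by (subst shuffle_sum_unit_right[of _ ds], simp, subst shuffle_sum_unit_right[of _ cs]) simp_all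
qed

definition outer_pairing :: "('a \<Rightarrow> 'd \<Rightarrow> rat) \<Rightarrow> ('a, 'b, 'c, 'd) quadform" where
  "outer_pairing P = (\<lambda>as bs cs ds.
     if length as = 1 \<and> bs = [] \<and> cs = [] \<and> length ds = 1 then P (hd as) (hd ds) else 0)"

definition pairing_class ::
  "('a \<Rightarrow> 'd \<Rightarrow> rat) \<Rightarrow> ('b \<Rightarrow> 'c \<Rightarrow> rat) \<Rightarrow> ('a, 'b, 'c, 'd) quadform" where
  "pairing_class P Q = (\<lambda>as bs cs ds. outer_pairing P as bs cs ds + outer_pairing Q bs as ds cs)"

definition det_class ::
  "('a \<Rightarrow> 'd \<Rightarrow> rat) \<Rightarrow> ('b \<Rightarrow> 'c \<Rightarrow> rat) \<Rightarrow> nat \<Rightarrow> ('a, 'b, 'c, 'd) quadform" where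
  "det_class P Q k = (\<lambda>as bs cs ds.
     if length as + length bs = k then pairing_det P as ds * pairing_det Q bs cs else 0)"

lemma det_class_swap: "det_class P Q k as bs cs ds = det_class Q P k bs as ds cs"
  by (simp add: det_class_def add.commute)

lemma kprod_outer_pairing:
  "kprod (outer_pairing P) W as bs cs ds =
    (\<Sum>i<length as. \<Sum>j<length ds. (-1) ^ (i + j) * P (as ! i) (ds ! j) *
      ((-1) ^ (length cs + (length ds - 1)) * W (nths as (- {i})) bs cs (nths ds (- {j}))))"
proof -
  have "kprod (outer_pairing P) W as bs cs ds =
    (\<Sum>i<length as. (-1) ^ i * shuffle_sum (\<lambda>d d'. (-1) ^ (length cs + length d') *
      (if length d = 1 then P (as ! i) (hd d) else 0) * W (nths as (- {i})) bs cs d') ds)"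
    unfolding kprod_eq_shuffle_sum outer_pairing_def
    by (simp add: shuffle_sum_singleton_left shuffle_sum_unit_left)
  also have "\<dots> = (\<Sum>i<length as. (-1) ^ i * (\<Sum>j<length ds. (-1) ^ j *
      ((-1) ^ (length cs + (length ds - 1)) * P (as ! i) (ds ! j) *
        W (nths as (- {i})) bs cs (nths ds (- {j})))))"
    by (simp add: shuffle_sum_singleton_left)
  finally show ?thesis
    by (simp add: sum_distrib_left power_add mult_ac)
qed

lemma det_class_minor:
  assumes "i < length as" and "j < length ds"
  shows "(-1) ^ (length cs + (length ds - 1)) *
      det_class P Q k (nths as (- {i})) bs cs (nths ds (- {j})) =
    (if length as + length bs = Suc k
     then (-1) ^ k * pairing_det Q bs cs * pairing_det P (nths as (- {i})) (nths ds (- {j})) else 0)"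
proof (cases "length as = length ds \<and> length bs = length cs")
  case True
  then have lengths: "length cs + (length ds - 1) = length as - 1 + length bs"
    and "length as - 1 + length bs = k \<longleftrightarrow> length as + length bs = Suc k"
    using assms by linarith+
  then show ?thesis
    using assms unfolding lengths by (simp add: det_class_def)
next
  case False
  then have "length as - 1 \<noteq> length ds - 1 \<or> length bs \<noteq> length cs"
    using assms by linarith
  then show ?thesis
    using assms by (auto simp: det_class_def pairing_det_length_neq)
qed

lemma kprod_outer_det_class:
  "kprod (outer_pairing P) (det_class P Q k) as bs cs ds =
    (-1) ^ k * of_nat (length as) * det_class P Q (Suc k) as bs cs ds"
proof -
  have "kprod (outer_pairing P) (det_class P Q k) as bs cs ds =
    (\<Sum>i<length as. \<Sum>j<length ds.
      (if length as + length bs = Suc k then (-1) ^ k * pairing_det Q bs cs else 0) *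
      ((-1) ^ (i + j) * P (as ! i) (ds ! j) * pairing_det P (nths as (- {i})) (nths ds (- {j}))))"
    unfolding kprod_outer_pairing
    by (intro sum.cong refl) (simp only: lessThan_iff det_class_minor, simp)
  also have "\<dots> = (if length as + length bs = Suc k then (-1) ^ k * pairing_det Q bs cs else 0) *
      (of_nat (length as) * pairing_det P as ds)"
    by (simp only: sum_pairing_det_minors flip: sum_distrib_left)
  finally show ?thesis
    by (simp add: det_class_def)
qed

lemma kprod_pairing_class_det_class:
  "kprod (pairing_class P Q) (det_class P Q k) as bs cs ds =
    (-1) ^ k * of_nat (Suc k) * det_class P Q (Suc k) as bs cs ds"
proof -
  have swap: "det_class P Q k = (\<lambda>as bs cs ds. det_class Q P k bs as ds cs)"
    by (intro ext) (rule det_class_swap)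
  have "kprod (\<lambda>as bs cs ds. outer_pairing Q bs as ds cs) (det_class P Q k) as bs cs ds =
      kprod (outer_pairing Q) (det_class Q P k) bs as ds cs"
    unfolding swap by (rule kprod_swap)
  also have "\<dots> = (-1) ^ k * of_nat (length bs) * det_class P Q (Suc k) as bs cs ds"
    unfolding kprod_outer_det_class det_class_swap[of Q P] ..
  finally have "kprod (pairing_class P Q) (det_class P Q k) as bs cs ds =
      (-1) ^ k * of_nat (length as + length bs) * det_class P Q (Suc k) as bs cs ds"
    unfolding pairing_class_def kprod_add_left kprod_outer_det_class by (simp add: algebra_simps)
  then show ?thesis
    by (simp add: det_class_def)
qed

text \<open>Moving the \<open>k\<close> factors on the first torus past those on the second costs the sign
  \<open>(-1)^(k(k-1)/2)\<close>; each of the \<open>k!\<close> orderings contributes the same product of determinants.\<close>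

lemma kpower_pairing_class:
  "kpower (pairing_class P Q) k =
    (\<lambda>as bs cs ds. fact k * (-1) ^ (k * (k - 1) div 2) * det_class P Q k as bs cs ds)"
proof (induction k)
  case 0
  show ?case
    by (auto simp: fun_eq_iff ktens_def unit_class_def tens_def unit_form_def det_class_def
        pairing_det_length_neq)
next
  case (Suc k)
  have "Suc k * (Suc k - 1) = k * (k - 1) + 2 * k"
    by (cases k) auto
  then have "Suc k * (Suc k - 1) div 2 = k + k * (k - 1) div 2"
    by simp
  then have sign: "(-1 :: rat) ^ (Suc k * (Suc k - 1) div 2) = (-1) ^ k * (-1) ^ (k * (k - 1) div 2)"
    by (simp only: power_add)
  show ?case
    unfolding kpower.simps Suc.IH kprod_mult_right kprod_pairing_class_det_class sign fact_Suc
    by (intro ext) (simp only: mult_ac)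
qed

lemma kexp_pairing_class:
  "kexp (pairing_class P Q) as bs cs ds =
    (-1) ^ ((length cs + length ds) * (length cs + length ds - 1) div 2) *
      pairing_det P as ds * pairing_det Q bs cs"
proof -
  let ?k = "length as + length bs"
  have "kexp (pairing_class P Q) as bs cs ds =
      (\<Sum>k\<in>{?k}. 1 / fact k * kpower (pairing_class P Q) k as bs cs ds)"
    unfolding kexp_def
    by (rule Sum_any.expand_superset) (auto simp: kpower_pairing_class det_class_def)
  also have "\<dots> = (-1) ^ (?k * (?k - 1) div 2) * pairing_det P as ds * pairing_det Q bs cs"
    by (simp add: kpower_pairing_class det_class_def)
  finally show ?thesis
    by (cases "length as = length ds \<and> length bs = length cs")
      (auto simp: pairing_det_length_neq add.commute)
qed

subsection \<open>Lattices and their duals\<close>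

definition int_combination :: "nat \<Rightarrow> (nat \<Rightarrow> 'v::real_vector) \<Rightarrow> (nat \<Rightarrow> int) \<Rightarrow> 'v" where
  "int_combination g b c = (\<Sum>i<g. real_of_int (c i) *\<^sub>R b i)"

lemma int_combination_add:
  "int_combination g b c + int_combination g b d = int_combination g b (\<lambda>i. c i + d i)"
  by (simp add: int_combination_def sum.distrib scaleR_left_distrib)

lemma int_combination_scale:
  "real_of_int k *\<^sub>R int_combination g b c = int_combination g b (\<lambda>i. k * c i)"
  by (simp add: int_combination_def scaleR_sum_right)

lemma int_combination_unit:
  assumes "i < g"
  shows "int_combination g b (\<lambda>j. if j = i then 1 else 0) = b i"
proof -
  have "int_combination g b (\<lambda>j. if j = i then 1 else 0) = (\<Sum>j<g. if j = i then b i else 0)"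
    unfolding int_combination_def by (rule sum.cong) auto
  with assms show ?thesis
    by simp
qed

lemma dual_add: "f \<in> dual M \<Longrightarrow> v \<in> M \<Longrightarrow> w \<in> M \<Longrightarrow> f (v + w) = f v + f w"
  by (simp add: dual_def)

lemma dual_outside: "f \<in> dual M \<Longrightarrow> v \<notin> M \<Longrightarrow> f v = 0"
  by (simp add: dual_def)

lemma bidual_in_dual: "bidual M v \<in> dual (dual M)"
  by (auto simp: dual_def bidual_def)

lemma wedge_list_bidual:
  assumes "set \<mu>s \<subseteq> dual M"
  shows "wedge_list (map (bidual M) vs) \<mu>s = wedge_list \<mu>s vs"
proof -
  have "wedge_list (map (bidual M) vs) \<mu>s = pairing_det (\<lambda>\<mu> v. of_int (\<mu> v)) \<mu>s vs"
    unfolding wedge_list_eq_pairing_det pairing_det_map_right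
    by (rule pairing_det_cong) (use assms in \<open>auto simp: bidual_def\<close>)
  also have "\<dots> = wedge_list \<mu>s vs"
    unfolding wedge_list_eq_pairing_det by (rule pairing_det_transpose)
  finally show ?thesis .
qed

context
  fixes g :: nat and b :: "nat \<Rightarrow> 'v::real_vector" and M :: "'v set"
  assumes basis: "lattice_basis g b M"
begin

lemma lattice_basis_eq_range: "M = range (int_combination g b)"
  using basis by (auto simp: lattice_basis_def int_combination_def)

lemma lattice_basis_add: "v \<in> M \<Longrightarrow> w \<in> M \<Longrightarrow> v + w \<in> M"
  by (auto simp: lattice_basis_eq_range int_combination_add)

lemma lattice_basis_scale: "v \<in> M \<Longrightarrow> real_of_int k *\<^sub>R v \<in> M"
  by (auto simp: lattice_basis_eq_range int_combination_scale)

lemma lattice_basis_uminus: "v \<in> M \<Longrightarrow> - v \<in> M"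
  using lattice_basis_scale[of v "-1"] by simp

lemma lattice_basis_zero: "0 \<in> M"
  unfolding lattice_basis_eq_range
  by (rule range_eqI[of _ _ "\<lambda>i. 0"]) (simp add: int_combination_def)

lemma lattice_basis_mem: "i < g \<Longrightarrow> b i \<in> M"
  unfolding lattice_basis_eq_range by (metis int_combination_unit rangeI)

lemma lattice_basis_sum: "(\<And>i. i \<in> I \<Longrightarrow> v i \<in> M) \<Longrightarrow> sum v I \<in> M"
  by (induction I rule: infinite_finite_induct) (auto simp: lattice_basis_zero lattice_basis_add)

lemma dual_zero: "f \<in> dual M \<Longrightarrow> f 0 = 0"
  using dual_add[of f M 0 0] lattice_basis_zero by simp

lemma dual_uminus:
  assumes f: "f \<in> dual M" and v: "v \<in> M"
  shows "f (- v) = - f v"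
  using dual_add[OF f v lattice_basis_uminus[OF v]] dual_zero[OF f] by simp

lemma dual_scale:
  assumes f: "f \<in> dual M" and v: "v \<in> M"
  shows "f (real_of_int k *\<^sub>R v) = k * f v"
proof (induction k rule: int_induct[of _ 0])
  case (step1 k)
  have "real_of_int (k + 1) *\<^sub>R v = real_of_int k *\<^sub>R v + v"
    by (simp add: scaleR_left_distrib)
  then show ?case
    using dual_add[OF f lattice_basis_scale[OF v] v] step1 by (simp add: algebra_simps)
next
  case (step2 k)
  have "real_of_int (k - 1) *\<^sub>R v = real_of_int k *\<^sub>R v + - v"
    by (simp add: scaleR_left_diff_distrib)
  then show ?case
    using dual_add[OF f lattice_basis_scale[OF v] lattice_basis_uminus[OF v]] dual_uminus[OF f v] step2
    by (simp add: algebra_simps)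
qed (simp add: dual_zero[OF f])

lemma dual_sum:
  assumes f: "f \<in> dual M"
  shows "(\<And>i. i \<in> I \<Longrightarrow> v i \<in> M) \<Longrightarrow> f (sum v I) = (\<Sum>i\<in>I. f (v i))"
  by (induction I rule: infinite_finite_induct)
    (auto simp: dual_zero[OF f] dual_add[OF f] lattice_basis_sum)

lemma dual_int_combination:
  assumes f: "f \<in> dual M"
  shows "f (int_combination g b c) = (\<Sum>i<g. c i * f (b i))"
  unfolding int_combination_def
  by (subst dual_sum[OF f]) (simp_all add: dual_scale[OF f] lattice_basis_scale lattice_basis_mem)

lemma dual_eqI:
  assumes "f \<in> dual M" "h \<in> dual M" and "\<And>i. i < g \<Longrightarrow> f (b i) = h (b i)"
  shows "f = h"
proof
  fix v
  show "f v = h v"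
  proof (cases "v \<in> M")
    case True
    then show ?thesis
      by (auto simp: lattice_basis_eq_range dual_int_combination[OF assms(1)]
          dual_int_combination[OF assms(2)] assms(3))
  qed (simp add: dual_outside[OF assms(1)] dual_outside[OF assms(2)])
qed

lemma representation_int_combination:
  assumes "i < g"
  shows "representation (b ` {..<g}) (int_combination g b c) (b i) = real_of_int (c i)"
proof -
  have inj: "inj_on b {..<g}" and indep: "independent (b ` {..<g})"
    using basis by (auto simp: lattice_basis_def)
  have span: "b j \<in> span (b ` {..<g})" if "j < g" for j
    using that by (intro span_base) auto
  have "representation (b ` {..<g}) (int_combination g b c) (b i) =
      (\<Sum>j<g. real_of_int (c j) * representation (b ` {..<g}) (b j) (b i))"
    unfolding int_combination_def
    by (subst representation_sum[OF indep]) (simp_all add: representation_scale[OF indep] span span_scale)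
  also have "\<dots> = (\<Sum>j<g. if j = i then real_of_int (c i) else 0)"
    by (rule sum.cong) (use assms inj in \<open>auto simp: representation_basis[OF indep] inj_on_eq_iff\<close>)
  finally show ?thesis
    using assms by simp
qed

lemma coordinate_functional_exists:
  assumes i: "i < g"
  obtains f where "f \<in> dual M" and "\<And>c. f (int_combination g b c) = c i"
proof
  let ?f = "\<lambda>v. if v \<in> M then \<lfloor>representation (b ` {..<g}) v (b i)\<rfloor> else 0"
  show f: "?f (int_combination g b c) = c i" for c
    by (simp add: representation_int_combination[OF i] lattice_basis_eq_range)
  have "?f (v + w) = ?f v + ?f w" if vw: "v \<in> M" "w \<in> M" for v w
  proof -
    obtain c d where "v = int_combination g b c" "w = int_combination g b d"
      using vw by (auto simp: lattice_basis_eq_range)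
    then show ?thesis
      by (simp only: int_combination_add f)
  qed
  then show "?f \<in> dual M"
    by (simp add: dual_def)
qed

lemma
  assumes i: "i < g"
  shows dual_basis_in_dual: "dual_basis g b M i \<in> dual M"
    and dual_basis_int_combination: "dual_basis g b M i (int_combination g b c) = c i"
proof -
  obtain f where f: "f \<in> dual M" and coord: "\<And>c. f (int_combination g b c) = c i"
    using coordinate_functional_exists[OF i] by blast
  have "f (b j) = (if j = i then 1 else 0)" if "j < g" for j
    using coord[of "\<lambda>k. if k = j then 1 else 0"] int_combination_unit[OF that, of b] by auto
  then have "dual_basis g b M i = f"
    unfolding dual_basis_def using f by (intro the_equality) (auto intro!: dual_eqI)
  with f coord show "dual_basis g b M i \<in> dual M" "dual_basis g b M i (int_combination g b c) = c i"
    by simp_all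
qed

lemma dual_basis_basis:
  assumes "i < g" and "j < g"
  shows "dual_basis g b M i (b j) = (if j = i then 1 else 0)"
  using dual_basis_int_combination[OF assms(1), of "\<lambda>k. if k = j then 1 else 0"]
    int_combination_unit[OF assms(2), of b]
  by auto

lemma dual_expand:
  assumes f: "f \<in> dual M"
  shows "f v = (\<Sum>i<g. f (b i) * dual_basis g b M i v)"
proof (cases "v \<in> M")
  case True
  then obtain c where "v = int_combination g b c"
    by (auto simp: lattice_basis_eq_range)
  then show ?thesis
    by (simp add: dual_int_combination[OF f] dual_basis_int_combination mult.commute)
next
  case False
  then show ?thesis
    by (simp add: dual_outside[OF f] dual_outside[OF dual_basis_in_dual])
qed

lemma bidual_expand:
  "bidual M v \<mu> = (\<Sum>i<g. dual_basis g b M i v * bidual M (b i) \<mu>)"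
  using dual_expand[of \<mu> v] by (simp add: bidual_def mult.commute)

lemma dual_separates:
  assumes "v \<in> M" "w \<in> M" and eq: "\<And>f. f \<in> dual M \<Longrightarrow> f v = f w"
  shows "v = w"
proof -
  obtain c d where cd: "v = int_combination g b c" "w = int_combination g b d"
    using assms(1,2) by (auto simp: lattice_basis_eq_range)
  then have "c i = d i" if "i < g" for i
    using eq[OF dual_basis_in_dual[OF that]] that by (simp add: dual_basis_int_combination)
  then show ?thesis
    unfolding cd by (simp add: int_combination_def)
qed

lemma the_lattice_element_eq:
  assumes "u \<in> M" and "\<And>\<mu>. \<mu> \<in> dual M \<Longrightarrow> of_int (\<mu> u) = (F \<mu> :: rat)"
  shows "(THE u. u \<in> M \<and> (\<forall>\<mu> \<in> dual M. of_int (\<mu> u) = F \<mu>)) = u"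
proof (rule the_equality)
  fix w
  assume "w \<in> M \<and> (\<forall>\<mu> \<in> dual M. of_int (\<mu> w) = F \<mu>)"
  then show "w = u"
    using assms by (intro dual_separates) (auto simp flip: of_int_eq_iff[where 'a = rat])
qed (use assms in auto)

lemma wedge_list_dual_basis_basis:
  "wedge_list (map (dual_basis g b M) [0..<g]) (map b [0..<g]) = 1"
proof -
  have "mat g g (\<lambda>(i, j). of_int ((map (dual_basis g b M) [0..<g] ! j) (map b [0..<g] ! i)) :: rat) =
      1\<^sub>m g"
    by (rule eq_matI) (auto simp: dual_basis_basis)
  then show ?thesis
    by (simp add: wedge_list_eq_pairing_det pairing_det_def)
qed

lemma wedge_list_top_degree:
  assumes "set \<mu>s \<subseteq> dual M" and "length \<mu>s = g"
  shows "wedge_list \<mu>s vs =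
    wedge_list \<mu>s (map b [0..<g]) * wedge_list (map (dual_basis g b M) [0..<g]) vs"
proof -
  have expand: "of_int (\<mu> v) = (\<Sum>k<g. of_int (dual_basis g b M k v) * of_int (\<mu> (b k)) :: rat)"
    if "\<mu> \<in> set \<mu>s" for \<mu> v
    using dual_expand[of \<mu> v] assms(1) that by (auto simp: mult.commute)
  show ?thesis
    unfolding wedge_list_eq_pairing_det pairing_det_map_left pairing_det_map_right
    by (subst mult.commute, rule pairing_det_mult[OF assms(2)]) (rule expand)
qed

end

text \<open>Outside the dual lattice \<open>bidual M v\<close> takes the value 0, so that \<open>dual_negate M \<mu>\<close> is a
  functional for every \<open>\<mu>\<close>.\<close>

definition dual_negate :: "'v::ab_group_add set \<Rightarrow> ('v \<Rightarrow> int) \<Rightarrow> 'v \<Rightarrow> int" where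
  "dual_negate M \<mu> v = - bidual M v \<mu>"

lemma dual_negate_in_dual: "dual_negate M \<mu> \<in> dual M"
  by (auto simp: dual_def dual_negate_def bidual_def)

lemma transpose_map_eq_dual_negate:
  assumes M: "lattice_basis g b M" and f: "\<And>v. v \<in> M \<Longrightarrow> f v = - v" and \<mu>: "\<mu> \<in> dual M"
  shows "transpose_map M f \<mu> = dual_negate M \<mu>"
  using dual_uminus[OF M \<mu>] dual_outside[OF \<mu>]
  by (auto simp: fun_eq_iff transpose_map_def dual_negate_def bidual_def f \<mu>)

lemma wedge_list_dual_negate_outside:
  assumes "\<not> set \<mu>s \<subseteq> dual M"
  shows "wedge_list (map (dual_negate M) \<mu>s) = 0"
proof (rule wedge_list_zero_factor)
  obtain \<mu> where "\<mu> \<in> set \<mu>s" "\<mu> \<notin> dual M"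
    using assms by blast
  then show "(\<lambda>v. 0) \<in> set (map (dual_negate M) \<mu>s)"
    by (force simp: dual_negate_def bidual_def)
qed

subsection \<open>Tropical cohomology classes\<close>

lemma ext_tensor_induct [consumes 1, case_names zero wedge_list diff]:
  assumes "z \<in> ext_tensor A B q p"
    and "P 0"
    and "\<And>\<mu>s \<nu>s. \<lbrakk>set \<mu>s \<subseteq> dual A; length \<mu>s = q; set \<nu>s \<subseteq> dual B; length \<nu>s = p\<rbrakk>
      \<Longrightarrow> P (wedge_list \<mu>s \<otimes>\<^sub>f wedge_list \<nu>s)"
    and "\<And>x y. \<lbrakk>x \<in> ext_tensor A B q p; y \<in> ext_tensor A B q p; P x; P y\<rbrakk> \<Longrightarrow> P (x - y)"
  shows "P z"
  using assms(1) unfolding ext_tensor_def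
proof (induction rule: group_closure.induct)
  case (base s)
  then show ?case
    using assms(2,3) by (auto simp: in_lists_conv_set subset_iff)
next
  case (diff s t)
  then show ?case
    using assms(4) unfolding ext_tensor_def by blast
qed

lemma ext_tensor_wedge_list:
  "\<lbrakk>set \<mu>s \<subseteq> dual A; length \<mu>s = q; set \<nu>s \<subseteq> dual B; length \<nu>s = p\<rbrakk>
    \<Longrightarrow> wedge_list \<mu>s \<otimes>\<^sub>f wedge_list \<nu>s \<in> ext_tensor A B q p"
  unfolding ext_tensor_def by (rule group_closure.base, rule insertI2) (auto simp: lists_eq_set)

lemma ext_tensor_zero: "0 \<in> ext_tensor A B q p"
  unfolding ext_tensor_def by (rule zero_in_group_closure)

lemma ext_tensor_diff: "\<lbrakk>z \<in> ext_tensor A B q p; w \<in> ext_tensor A B q p\<rbrakk> \<Longrightarrow> z - w \<in> ext_tensor A B q p"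
  unfolding ext_tensor_def by (rule group_closure.diff)

lemma ext_tensor_add: "\<lbrakk>z \<in> ext_tensor A B q p; w \<in> ext_tensor A B q p\<rbrakk> \<Longrightarrow> z + w \<in> ext_tensor A B q p"
  unfolding ext_tensor_def by (rule group_closure_add)

lemma ext_tensor_scale:
  assumes z: "z \<in> ext_tensor A B q p" and "r \<in> \<int>"
  shows "(\<lambda>as bs. r * z as bs) \<in> ext_tensor A B q p"
proof -
  have scale_of_nat: "(\<lambda>as bs. of_nat n * z as bs) \<in> ext_tensor A B q p" for n
    using group_closure_scalar_mult_left[of z _ n] z
    unfolding ext_tensor_def by (simp add: times_fun_def of_nat_fun)
  obtain k where k: "r = of_int k"
    using assms(2) by (auto elim: Ints_cases)
  show ?thesis
  proof (cases k)
    case (nonneg n)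
    with scale_of_nat[of n] k show ?thesis
      by simp
  next
    case (neg n)
    with k have "r = - of_nat (Suc n)"
      by simp
    with ext_tensor_diff[OF ext_tensor_zero scale_of_nat[of "Suc n"]] show ?thesis
      by (simp add: fun_diff_def zero_fun_def del: of_nat_Suc)
  qed
qed

lemma ext_tensor_shuffle_sum:
  assumes "\<And>us ws. length us + length ws = length xs \<Longrightarrow> z us ws \<in> ext_tensor A B q p"
  shows "(\<lambda>as bs. shuffle_sum (\<lambda>us ws. z us ws as bs) xs) \<in> ext_tensor A B q p"
  using assms
proof (induction xs arbitrary: z)
  case (Cons x xs)
  have "(\<lambda>as bs. shuffle_sum (\<lambda>us ws. z (x # us) ws as bs) xs) \<in> ext_tensor A B q p"
    by (rule Cons.IH) (simp add: Cons.prems)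
  moreover have "(\<lambda>as bs. shuffle_sum (\<lambda>us ws. (-1) ^ length us * z us (x # ws) as bs) xs)
      \<in> ext_tensor A B q p"
    by (rule Cons.IH[of "\<lambda>us ws as bs. (-1) ^ length us * z us (x # ws) as bs"])
      (simp add: Cons.prems ext_tensor_scale)
  ultimately show ?case
    using ext_tensor_add by (fastforce simp: plus_fun_def)
qed simp

lemma ext_tensor_Ints:
  assumes "z \<in> ext_tensor A B q p"
  shows "z as bs \<in> \<int>"
  using assms by (induction rule: ext_tensor_induct) (auto simp: tens_def wedge_list_Ints)

lemma ext_tensor_support:
  assumes "z \<in> ext_tensor A B q p"
    and "\<not> (set as \<subseteq> A \<and> length as = q \<and> set bs \<subseteq> B \<and> length bs = p)"
  shows "z as bs = 0"
  using assms(1)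
proof (induction rule: ext_tensor_induct)
  case (wedge_list \<mu>s \<nu>s)
  have outside: "wedge_list \<kappa>s vs = 0" if "set \<kappa>s \<subseteq> dual C" "v \<in> set vs" "v \<notin> C"
    for \<kappa>s :: "('c::ab_group_add \<Rightarrow> int) list" and vs v C
    using that dual_outside by (intro wedge_list_zero_argument[OF that(2)]) blast
  consider "length as \<noteq> q" | "length bs \<noteq> p" | v where "v \<in> set as" "v \<notin> A" | v where "v \<in> set bs" "v \<notin> B"
    using assms(2) by auto
  then show ?case
    by cases (use wedge_list in \<open>auto simp: tens_def wedge_list_length_neq dest: outside\<close>)
qed auto

lemma cup_diff_left: "(x - x') \<smile> y = (x \<smile> y) - (x' \<smile> y)"
  by (simp add: fun_eq_iff cup_eq_shuffle_sum shuffle_sum_diff left_diff_distrib)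

lemma cup_diff_right: "y \<smile> (x - x') = (y \<smile> x) - (y \<smile> x')"
  by (simp add: fun_eq_iff cup_eq_shuffle_sum shuffle_sum_diff right_diff_distrib)

lemma cup_zero_left: "0 \<smile> x = 0"
  by (simp add: fun_eq_iff cup_eq_shuffle_sum)

lemma cup_zero_right: "x \<smile> 0 = 0"
  by (simp add: fun_eq_iff cup_eq_shuffle_sum)

lemma cup_scale_left: "(\<lambda>as bs. r * x as bs) \<smile> y = (\<lambda>as bs. r * (x \<smile> y) as bs)"
  by (simp add: fun_eq_iff cup_eq_shuffle_sum shuffle_sum_mult_left mult.assoc)

lemma ext_tensor_cup:
  assumes y: "y \<in> ext_tensor A B q p" and x: "x \<in> ext_tensor A B q' p'"
  shows "y \<smile> x \<in> ext_tensor A B (q + q') (p + p')"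
  using y
proof (induction rule: ext_tensor_induct)
  case zero
  show ?case
    by (simp only: cup_zero_left ext_tensor_zero)
next
  case (wedge_list \<mu>s \<nu>s)
  note y_lists = this
  show ?case
    using x
  proof (induction rule: ext_tensor_induct)
    case zero
    show ?case
      by (simp only: cup_zero_right ext_tensor_zero)
  next
    case (wedge_list \<mu>s' \<nu>s')
    with y_lists show ?case
      unfolding cup_tens wedge_list_append[symmetric] by (intro ext_tensor_wedge_list) auto
  next
    case (diff x x')
    then show ?case
      by (simp only: cup_diff_right ext_tensor_diff)
  qed
next
  case (diff y y')
  then show ?case
    by (simp only: cup_diff_left ext_tensor_diff)
qed

subsection \<open>Poincare duality\<close>

text \<open>Because
  \<open>(\<mu>\<^sub>1 \<and> \<dots> \<and> \<mu>\<^sub>k)(v\<^sub>1, \<dots>, v\<^sub>k) = (v\<^sub>1 \<and> \<dots> \<and> v\<^sub>k)(\<mu>\<^sub>1, \<dots>, \<mu>\<^sub>k)\<close>, contracting with the bases of the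
  lattices displays the Poincare dual functional as an integral element.\<close>

definition contraction ::
  "'a::ab_group_add set \<Rightarrow> 'b::ab_group_add set \<Rightarrow> 'a list \<Rightarrow> 'b list \<Rightarrow> ('a, 'b) biform \<Rightarrow>
   ('a \<Rightarrow> int, 'b \<Rightarrow> int) biform" where
  "contraction A B us ws x = (\<lambda>\<mu>s \<nu>s.
     shuffle_sum (\<lambda>u u'. shuffle_sum (\<lambda>w w'.
       x u' w' * (wedge_list (map (bidual A) u) \<otimes>\<^sub>f wedge_list (map (bidual B) w)) \<mu>s \<nu>s) ws) us)"

lemma contraction_eq_cup:
  assumes "set \<mu>s \<subseteq> dual A" and "set \<nu>s \<subseteq> dual B"
  shows "contraction A B us ws x \<mu>s \<nu>s = (wedge_list \<mu>s \<otimes>\<^sub>f wedge_list \<nu>s \<smile> x) us ws"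
  by (simp add: contraction_def cup_eq_shuffle_sum tens_def wedge_list_bidual assms mult.commute)

lemma contraction_in_ext_tensor:
  assumes x: "x \<in> ext_tensor A B q p"
  shows "contraction A B us ws x \<in> ext_tensor (dual A) (dual B) (length us - q) (length ws - p)"
  unfolding contraction_def
proof (intro ext_tensor_shuffle_sum)
  fix u u' :: "'a list" and w w' :: "'b list"
  assume lengths: "length u + length u' = length us" "length w + length w' = length ws"
  let ?z = "wedge_list (map (bidual A) u) \<otimes>\<^sub>f wedge_list (map (bidual B) w)"
  show "(\<lambda>\<mu>s \<nu>s. x u' w' * ?z \<mu>s \<nu>s) \<in> ext_tensor (dual A) (dual B) (length us - q) (length ws - p)"
  proof (cases "length u' = q \<and> length w' = p")
    case True
    then show ?thesis
      using lengths
      by (intro ext_tensor_scale ext_tensor_wedge_list ext_tensor_Ints[OF x]) (auto simp: bidual_in_dual)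
  next
    case False
    then have "x u' w' = 0"
      by (intro ext_tensor_support[OF x]) auto
    then show ?thesis
      using ext_tensor_zero by (simp add: zero_fun_def)
  qed
qed

lemma element_of_functional_eqI:
  assumes z: "z \<in> ext_tensor (dual A) (dual B) q p"
    and eq: "\<And>\<mu>s \<nu>s. \<lbrakk>set \<mu>s \<subseteq> dual A; set \<nu>s \<subseteq> dual B\<rbrakk> \<Longrightarrow>
      z \<mu>s \<nu>s = \<phi> (wedge_list \<mu>s \<otimes>\<^sub>f wedge_list \<nu>s)"
  shows "element_of_functional A B q p \<phi> = z"
  unfolding element_of_functional_def
proof (rule the_equality, goal_cases existence uniqueness)
  case existence
  show ?case
    using z eq by (auto simp: in_lists_conv_set subset_iff)
next
  case (uniqueness w)
  show "w = z"
  proof (intro ext)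
    fix \<mu>s \<nu>s
    show "w \<mu>s \<nu>s = z \<mu>s \<nu>s"
    proof (cases "set \<mu>s \<subseteq> dual A \<and> length \<mu>s = q \<and> set \<nu>s \<subseteq> dual B \<and> length \<nu>s = p")
      case True
      then show ?thesis
        using uniqueness eq by (auto simp: in_lists_conv_set subset_iff)
    next
      case False
      then show ?thesis
        using ext_tensor_support[OF z False] ext_tensor_support[OF conjunct1[OF uniqueness] False] by simp
    qed
  qed
qed

context
  fixes g :: nat and N \<Lambda> :: "'v::real_vector set" and eta lam :: "nat \<Rightarrow> 'v"
  assumes N: "lattice_basis g eta N" and L: "lattice_basis g lam \<Lambda>"
begin

lemma bideg_proj_top_eq:
  assumes z: "z \<in> ext_tensor \<Lambda> N q p"
  shows "bideg_proj g g z as bs = z (map lam [0..<g]) (map eta [0..<g]) * top_class g N \<Lambda> eta lam as bs"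
  using z
proof (induction rule: ext_tensor_induct)
  case (wedge_list \<mu>s \<nu>s)
  show ?case
  proof (cases "q = g \<and> p = g")
    case True
    with wedge_list show ?thesis
      using wedge_list_top_degree[OF L, of \<mu>s as] wedge_list_top_degree[OF N, of \<nu>s bs]
      by (auto simp: bideg_proj_def tens_def top_class_def wedge_list_length_neq)
  next
    case False
    with wedge_list show ?thesis
      by (auto simp: bideg_proj_def tens_def wedge_list_length_neq)
  qed
qed (auto simp: bideg_proj_def left_diff_distrib)

lemma delta_eq_eval:
  assumes z: "z \<in> ext_tensor \<Lambda> N q p"
  shows "delta g N \<Lambda> eta lam z = z (map lam [0..<g]) (map eta [0..<g])"
  unfolding delta_def
proof (rule the_equality)
  show "bideg_proj g g z =
      (\<lambda>as bs. z (map lam [0..<g]) (map eta [0..<g]) * top_class g N \<Lambda> eta lam as bs)"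
    by (intro ext) (rule bideg_proj_top_eq[OF assms])
next
  fix c
  assume c: "bideg_proj g g z = (\<lambda>as bs. c * top_class g N \<Lambda> eta lam as bs)"
  have "top_class g N \<Lambda> eta lam (map lam [0..<g]) (map eta [0..<g]) = 1"
    by (simp add: top_class_def tens_def wedge_list_dual_basis_basis[OF N]
        wedge_list_dual_basis_basis[OF L])
  then show "c = z (map lam [0..<g]) (map eta [0..<g])"
    using fun_cong[OF fun_cong[OF c], of "map lam [0..<g]" "map eta [0..<g]"]
    by (simp add: bideg_proj_def)
qed

lemma delta_eq_0:
  assumes z: "z \<in> ext_tensor \<Lambda> N q p" and "q \<noteq> g \<or> p \<noteq> g"
  shows "delta g N \<Lambda> eta lam z = 0"
  unfolding delta_eq_eval[OF z] using assms(2) by (intro ext_tensor_support[OF z]) auto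

lemma delta_scale:
  assumes z: "z \<in> ext_tensor \<Lambda> N q p" and r: "r \<in> \<int>"
  shows "delta g N \<Lambda> eta lam (\<lambda>as bs. r * z as bs) = r * delta g N \<Lambda> eta lam z"
  unfolding delta_eq_eval[OF z] delta_eq_eval[OF ext_tensor_scale[OF z r]] ..

lemma poincare_duality_eq_delta:
  assumes x: "x \<in> ext_tensor \<Lambda> N q p"
    and \<mu>s: "set \<mu>s \<subseteq> dual \<Lambda>" and \<nu>s: "set \<nu>s \<subseteq> dual N"
  shows "poincare_duality g N \<Lambda> eta lam p q x \<mu>s \<nu>s =
    delta g N \<Lambda> eta lam (wedge_list \<mu>s \<otimes>\<^sub>f wedge_list \<nu>s \<smile> x)"
proof -
  let ?z = "contraction \<Lambda> N (map lam [0..<g]) (map eta [0..<g]) x"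
  have eval: "?z \<mu>s \<nu>s = delta g N \<Lambda> eta lam (wedge_list \<mu>s \<otimes>\<^sub>f wedge_list \<nu>s \<smile> x)"
    if "set \<mu>s \<subseteq> dual \<Lambda>" "set \<nu>s \<subseteq> dual N" for \<mu>s \<nu>s
    using that delta_eq_eval[OF ext_tensor_cup[OF ext_tensor_wedge_list x]]
    by (simp add: contraction_eq_cup)
  have "poincare_duality g N \<Lambda> eta lam p q x = ?z"
    unfolding poincare_duality_def
    using contraction_in_ext_tensor[OF x, of "map lam [0..<g]" "map eta [0..<g]"] eval
    by (intro element_of_functional_eqI) simp_all
  with eval[OF \<mu>s \<nu>s] show ?thesis
    by simp
qed

subsection \<open>The Fourier--Mukai transform\<close>

lemma c1_poincare_eq_pairing_class:
  "c1_poincare g N \<Lambda> eta lam =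
    pairing_class (\<lambda>v \<mu>. of_int (dual_negate \<Lambda> \<mu> v)) (\<lambda>v \<mu>. of_int (dual_negate N \<mu> v))"
proof (intro ext)
  fix as bs :: "'v list" and cs ds :: "('v \<Rightarrow> int) list"
  have sum_apply: "(\<Sum>i<g. F i) as bs cs ds = (\<Sum>i<g. F i as bs cs ds)"
    for F :: "nat \<Rightarrow> ('v, 'v, 'v \<Rightarrow> int, 'v \<Rightarrow> int) quadform"
    by (induction g) auto
  show "c1_poincare g N \<Lambda> eta lam as bs cs ds =
    pairing_class (\<lambda>v \<mu>. of_int (dual_negate \<Lambda> \<mu> v)) (\<lambda>v \<mu>. of_int (dual_negate N \<mu> v)) as bs cs ds"
    unfolding c1_poincare_def pairing_class_def outer_pairing_def dual_negate_def
      bidual_expand[OF N, of "hd bs"] bidual_expand[OF L, of "hd as"]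
    by (auto simp: sum_apply ktens_def tens_def unit_form_def one_form_def)
qed

lemma Psi_Lambda_c1_poincare:
  assumes v: "v \<in> \<Lambda>"
  shows "Psi_Lambda \<Lambda> (c1_poincare g N \<Lambda> eta lam) v = - v"
  unfolding Psi_Lambda_def c1_poincare_eq_pairing_class pairing_class_def outer_pairing_def
  using lattice_basis_uminus[OF L v] dual_uminus[OF L _ v]
  by (intro the_lattice_element_eq[OF L]) (simp_all add: dual_negate_def bidual_def)

lemma Psi_N_c1_poincare:
  assumes v: "v \<in> N"
  shows "Psi_N N (c1_poincare g N \<Lambda> eta lam) v = - v"
  unfolding Psi_N_def c1_poincare_eq_pairing_class pairing_class_def outer_pairing_def
  using lattice_basis_uminus[OF N v] dual_uminus[OF N _ v]
  by (intro the_lattice_element_eq[OF N]) (simp_all add: dual_negate_def bidual_def)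

lemma alpha_map_eq_delta:
  assumes x: "x \<in> ext_tensor \<Lambda> N q p"
  shows "alpha_map g N \<Lambda> eta lam p q x cs ds = delta g N \<Lambda> eta lam
    (wedge_list (map (dual_negate \<Lambda>) ds) \<otimes>\<^sub>f wedge_list (map (dual_negate N) cs) \<smile> x)"
    (is "_ = delta g N \<Lambda> eta lam (?y \<smile> x)")
proof (cases "ds \<in> lists (dual \<Lambda>) \<and> cs \<in> lists (dual N)")
  case True
  have transpose:
    "map (transpose_map \<Lambda> (Psi_Lambda \<Lambda> (c1_poincare g N \<Lambda> eta lam))) ds = map (dual_negate \<Lambda>) ds"
    "map (transpose_map N (Psi_N N (c1_poincare g N \<Lambda> eta lam))) cs = map (dual_negate N) cs"
    using True transpose_map_eq_dual_negate[OF L Psi_Lambda_c1_poincare]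
      transpose_map_eq_dual_negate[OF N Psi_N_c1_poincare] by (auto simp: in_lists_conv_set)
  from True show ?thesis
    unfolding alpha_map_def swap_factors_def induced_map_def transpose
    by (subst poincare_duality_eq_delta[OF x]) (auto simp: dual_negate_in_dual)
next
  case False
  then have "wedge_list (map (dual_negate \<Lambda>) ds) = 0 \<or> wedge_list (map (dual_negate N) cs) = 0"
    using wedge_list_dual_negate_outside by (auto simp: lists_eq_set)
  then have "?y = 0"
    by (auto simp: tens_def fun_eq_iff)
  then have "delta g N \<Lambda> eta lam (?y \<smile> x) = 0"
    using delta_eq_eval[OF ext_tensor_zero] by (simp only: cup_zero_left zero_fun_apply)
  moreover have "alpha_map g N \<Lambda> eta lam p q x cs ds = 0"
    using False by (auto simp: alpha_map_def swap_factors_def induced_map_def)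
  ultimately show ?thesis
    by simp
qed

lemma fourier_mukai_eq_delta:
  assumes x: "x \<in> ext_tensor \<Lambda> N q p"
  shows "fourier_mukai g N \<Lambda> eta lam x cs ds =
    (-1) ^ ((length cs + length ds) * (length cs + length ds - 1) div 2) * delta g N \<Lambda> eta lam
    (wedge_list (map (dual_negate \<Lambda>) ds) \<otimes>\<^sub>f wedge_list (map (dual_negate N) cs) \<smile> x)"
proof -
  let ?y = "wedge_list (map (dual_negate \<Lambda>) ds) \<otimes>\<^sub>f wedge_list (map (dual_negate N) cs)"
  let ?s = "(-1) ^ ((length cs + length ds) * (length cs + length ds - 1) div 2) :: rat"
  have y: "?y \<in> ext_tensor \<Lambda> N (length ds) (length cs)"
    by (rule ext_tensor_wedge_list) (auto simp: dual_negate_in_dual)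
  have "(\<lambda>as bs. kexp (c1_poincare g N \<Lambda> eta lam) as bs cs ds) = (\<lambda>as bs. ?s * ?y as bs)"
    unfolding c1_poincare_eq_pairing_class kexp_pairing_class tens_def wedge_list_eq_pairing_det
    by (simp add: pairing_det_map_right mult.assoc)
  then have "fourier_mukai g N \<Lambda> eta lam x cs ds = delta g N \<Lambda> eta lam (\<lambda>as bs. ?s * (?y \<smile> x) as bs)"
    unfolding fourier_mukai_def pushforward2_def kprod_pullback1 by (simp only: cup_scale_left)
  also have "\<dots> = ?s * delta g N \<Lambda> eta lam (?y \<smile> x)"
    by (rule delta_scale[OF ext_tensor_cup[OF y x]]) simp
  finally show ?thesis .
qed

end

lemma nat_int_triangular: "nat (int m * (int m - 1) div 2) = m * (m - 1) div 2"
proof -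
  have "int m * (int m - 1) = int (m * (m - 1))"
    by (cases m) (auto simp: algebra_simps)
  then show ?thesis
    by (metis nat_int of_nat_numeral zdiv_int)
qed

theorem proposition5p4:
  fixes g p q :: nat
    and N \<Lambda> :: "'v::real_vector set"
    and eta lam :: "nat \<Rightarrow> 'v"
    and x :: "('v, 'v) biform"
  assumes "real_torus g N \<Lambda>"
    and "lattice_basis g eta N"
    and "lattice_basis g lam \<Lambda>"
    and "same_orientation g eta lam"
    and "x \<in> trop_coh N \<Lambda> p q"
  shows "fourier_mukai g N \<Lambda> eta lam x =
    (\<lambda>cs ds.
      (-1) ^ nat ((2 * int g - (int p + int q)) * (2 * int g - (int p + int q) - 1) div 2)
      * alpha_map g N \<Lambda> eta lam p q x cs ds)"
proof (intro ext)
  fix cs ds :: "('v \<Rightarrow> int) list"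
  let ?s = "(-1) ^ nat ((2 * int g - (int p + int q)) * (2 * int g - (int p + int q) - 1) div 2) :: rat"
  let ?y = "wedge_list (map (dual_negate \<Lambda>) ds) \<otimes>\<^sub>f wedge_list (map (dual_negate N) cs)"
  note bases = assms(2,3) and x = assms(5)[unfolded trop_coh_def]
  have yx: "?y \<smile> x \<in> ext_tensor \<Lambda> N (length ds + q) (length cs + p)"
    by (intro ext_tensor_cup ext_tensor_wedge_list x) (auto simp: dual_negate_in_dual)
  show "fourier_mukai g N \<Lambda> eta lam x cs ds = ?s * alpha_map g N \<Lambda> eta lam p q x cs ds"
  proof (cases "length ds + q = g \<and> length cs + p = g")
    case True
    then have "2 * int g - (int p + int q) = int (length cs + length ds)"
      by linarith
    then show ?thesis
      by (simp only: nat_int_triangular fourier_mukai_eq_delta[OF bases x] alpha_map_eq_delta[OF bases x])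
  next
    case False
    then show ?thesis
      by (simp add: fourier_mukai_eq_delta[OF bases x] alpha_map_eq_delta[OF bases x]
          delta_eq_0[OF bases yx])
  qed
qed

end
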